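(* Consider a receiver that, with full recall, may either exchange at its current best realisable value $b$ or continue waiting for marked-Poisson arrivals (rate $\lambda>0$, i.i.d. marks $V\sim F^V$ with density $f>0$ on $[v_{\min},v_{\max}]$) at delay price $c_w$ per unit time. Define $T(\rho)=\int_\rho^{v_{\max}}(1-F^V(x))\,dx$. If $0<c_w<\lambda\,T(v_{\min})=\lambda\,\mathbb E[V-v_{\min}]$, then the optimal policy within stationary threshold policies is to exchange iff $b\ge\rho^\star$, where $\rho^\star\in(v_{\min},v_{\max})$ is the unique root of $$\lambda\int_{\rho^\star}^{v_{\max}}\bigl(1-F^V(x)\bigr)\,dx=c_w.$$ Moreover the reservation value equals the optimal continuation value, $\rho^\star=J(\rho^\star)$, where $J(\rho)$ is the expected net payoff of the threshold-$\rho$ policy. If instead $c_w\ge\lambda\,T(v_{\min})$, waiting is never worthwhile and $\rho^\star=v_{\min}$ (i.e. the optimal stationary threshold is $v_{\min}$: accept immediately).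
   Context: Contacts arrive as a Poisson process of rate $\lambda$; marks are i.i.d. with cumulative distribution function $F^V$, independent of arrival times, $v_{\min}<v_{\max}$. A stationary threshold policy with threshold $\rho\in[v_{\min},v_{\max})$ exchanges as soon as the best available value is at least $\rho$ and otherwise keeps waiting. $J(\rho)$ is the expected net payoff, when waiting, of the threshold-$\rho$ policy: the expectation of the mark of the first arrival with mark $\ge\rho$, minus $c_w$ times the time until that arrival. *)

theory Defs
  imports "HOL-Probability.Probability"
begin

text \<open>
  A Poisson process of rate \<open>lam\<close> is given by its i.i.d. exponential inter-arrival times \<open>A\<close>:
  the \<open>n\<close>-th arrival (counting from 1) happens at \<open>arrival_time A n\<close> and carries the mark
  \<open>V (n - 1)\<close>. Independence of the combined family \<open>case_sum A V\<close> expresses at once that the gaps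
  are independent, that the marks are independent, and that marks and arrival times are
  independent of each other.
\<close>

locale marked_poisson = prob_space M
  for M :: "'a measure" +
  fixes lam :: real
    and A :: "nat \<Rightarrow> 'a \<Rightarrow> real"
    and V :: "nat \<Rightarrow> 'a \<Rightarrow> real"
    and f :: "real \<Rightarrow> real"
    and vmin vmax :: real
  assumes rate_pos: "lam > 0"
    and vmin_less_vmax: "vmin < vmax"
    and gaps: "\<And>n. distributed M lborel (A n) (exponential_density lam)"
    and marks: "\<And>n. distributed M lborel (V n) f"
    and density_pos: "\<And>x. x \<in> {vmin..vmax} \<Longrightarrow> f x > 0"
    and density_zero: "\<And>x. x \<notin> {vmin..vmax} \<Longrightarrow> f x = 0"
    and indep: "indep_vars (\<lambda>_. borel) (case_sum A V) (UNIV :: (nat + nat) set)"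

definition arrival_time :: "(nat \<Rightarrow> 'a \<Rightarrow> real) \<Rightarrow> nat \<Rightarrow> 'a \<Rightarrow> real" where
  "arrival_time A n \<omega> = (\<Sum>i<n. A i \<omega>)"

definition mark_cdf :: "'a measure \<Rightarrow> (nat \<Rightarrow> 'a \<Rightarrow> real) \<Rightarrow> real \<Rightarrow> real" where
  "mark_cdf M V = cdf (distr M borel (V 0))"

definition tail_integral ::
    "'a measure \<Rightarrow> (nat \<Rightarrow> 'a \<Rightarrow> real) \<Rightarrow> real \<Rightarrow> real \<Rightarrow> real" where
  "tail_integral M V vmax \<rho> = (LBINT x:{\<rho>..vmax}. 1 - mark_cdf M V x)"

text \<open>
  The waiting payoff \<open>J \<rho>\<close>. For \<open>\<rho> < vmax\<close> an arrival with mark at least \<open>\<rho>\<close> exists almost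
  surely, so the value of \<open>LEAST\<close> on the remaining null set is irrelevant.
\<close>

definition first_mark_index :: "(nat \<Rightarrow> 'a \<Rightarrow> real) \<Rightarrow> real \<Rightarrow> 'a \<Rightarrow> nat" where
  "first_mark_index V \<rho> \<omega> = (LEAST n. \<rho> \<le> V n \<omega>)"

definition waiting_payoff ::
    "'a measure \<Rightarrow> (nat \<Rightarrow> 'a \<Rightarrow> real) \<Rightarrow> (nat \<Rightarrow> 'a \<Rightarrow> real) \<Rightarrow> real \<Rightarrow> real \<Rightarrow> real" where
  "waiting_payoff M A V cw \<rho> =
     (\<integral>\<omega>. V (first_mark_index V \<rho> \<omega>) \<omega>
           - cw * arrival_time A (Suc (first_mark_index V \<rho> \<omega>)) \<omega> \<partial>M)"

text \<open>
  Full recall: \<open>best_value V b n\<close> is the best value available after \<open>n\<close> further arrivals when the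
  current best value is \<open>b\<close>. The threshold policy exchanges as soon as this value reaches \<open>\<rho>\<close>,
  in particular immediately (index 0, time 0) if \<open>b \<ge> \<rho>\<close>.
\<close>

definition best_value :: "(nat \<Rightarrow> 'a \<Rightarrow> real) \<Rightarrow> real \<Rightarrow> nat \<Rightarrow> 'a \<Rightarrow> real" where
  "best_value V b n \<omega> = Max (insert b ((\<lambda>i. V i \<omega>) ` {..<n}))"

definition exchange_index :: "(nat \<Rightarrow> 'a \<Rightarrow> real) \<Rightarrow> real \<Rightarrow> real \<Rightarrow> 'a \<Rightarrow> nat" where
  "exchange_index V \<rho> b \<omega> = (LEAST n. \<rho> \<le> best_value V b n \<omega>)"

definition policy_payoff ::
    "'a measure \<Rightarrow> (nat \<Rightarrow> 'a \<Rightarrow> real) \<Rightarrow> (nat \<Rightarrow> 'a \<Rightarrow> real) \<Rightarrow> real \<Rightarrow> real \<Rightarrow> real \<Rightarrow> real" where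
  "policy_payoff M A V cw \<rho> b =
     (\<integral>\<omega>. best_value V b (exchange_index V \<rho> b \<omega>) \<omega>
           - cw * arrival_time A (exchange_index V \<rho> b \<omega>) \<omega> \<partial>M)"

text \<open>
  Optimality is uniform: one threshold has to be best, among all admissible thresholds,
  for every current best value \<open>b\<close>.
\<close>

definition optimal_threshold ::
    "'a measure \<Rightarrow> (nat \<Rightarrow> 'a \<Rightarrow> real) \<Rightarrow> (nat \<Rightarrow> 'a \<Rightarrow> real) \<Rightarrow> real \<Rightarrow> real \<Rightarrow> real \<Rightarrow> real \<Rightarrow> bool" where
  "optimal_threshold M A V cw vmin vmax \<rho> \<longleftrightarrow>
     \<rho> \<in> {vmin..<vmax} \<and>
     (\<forall>r\<in>{vmin..<vmax}. \<forall>b. policy_payoff M A V cw r b \<le> policy_payoff M A V cw \<rho> b)"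

end

theory Submission imports Defs begin

text \<open>
  Writing \<open>p r\<close> for the probability that a mark is at least \<open>r\<close>, a geometric series gives
  \<open>p r * (J r - \<rho>) = E [(V - \<rho>) * [r \<le> V]] - cw / lam\<close>. The expectation on the right is at most
  \<open>E [max (V - \<rho>) 0]\<close>, which is the tail integral \<open>T \<rho>\<close>, with equality only for \<open>r = \<rho>\<close> because
  the density is positive. If \<open>lam * T \<rho> = cw\<close>, this reads \<open>J \<rho> = \<rho>\<close> and \<open>J r < \<rho>\<close> for all other
  \<open>r\<close>. If \<open>lam * T vmin \<le> cw\<close>, taking \<open>\<rho> = vmin\<close> (where \<open>p vmin = 1\<close>) gives
  \<open>J r < J vmin \<le> vmin\<close>. Below its threshold a policy earns \<open>J\<close>, above it the current value, so
  a unique strict maximiser of \<open>J\<close> is the unique optimal threshold; uniqueness is visible from any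
  current value below \<open>vmin\<close>.
\<close>

lemma first_mark_index_ge: "\<exists>n. r \<le> V n \<omega> \<Longrightarrow> r \<le> V (first_mark_index V r \<omega>) \<omega>"
  unfolding first_mark_index_def by (rule LeastI_ex)

lemma less_first_mark_index: "i < first_mark_index V r \<omega> \<Longrightarrow> V i \<omega> < r"
  unfolding first_mark_index_def using not_less_Least by fastforce

context marked_poisson
begin

section \<open>Expectations of functions of a single mark\<close>

lemma measurable_A [measurable]: "A n \<in> borel_measurable M"
  using distributed_measurable[OF gaps] by simp

lemma measurable_V [measurable]: "V n \<in> borel_measurable M"
  using distributed_measurable[OF marks] by simp

lemma density_nonneg: "0 \<le> f x"
  by (cases "x \<in> {vmin..vmax}") (use density_zero density_pos[of x] in auto)

text \<open>Both sides equal the integral of \<open>g\<close> against the common density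
  \<open>f\<close>. This reduces every later expectation to the mark \<open>V 0\<close>.\<close>

lemma expectation_mark:
  fixes g :: "real \<Rightarrow> real"
  assumes "g \<in> borel_measurable borel"
  shows "expectation (\<lambda>\<omega>. g (V n \<omega>)) = expectation (\<lambda>\<omega>. g (V 0 \<omega>))"
proof -
  have "g \<in> borel_measurable lborel"
    using assms by simp
  from distributed_integral[OF marks this density_nonneg] show ?thesis
    by metis
qed

lemma AE_mark_bounds: "AE \<omega> in M. V n \<omega> \<in> {vmin..vmax}"
proof (subst distributed_AE2[OF marks])
  show "AE x in lborel. 0 < ennreal (f x) \<longrightarrow> x \<in> {vmin..vmax}"
    using density_zero by (intro AE_I2) (metis ennreal_0 less_irrefl)
qed simp

lemma integrable_mark:
  fixes g :: "real \<Rightarrow> real"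
  assumes [measurable]: "g \<in> borel_measurable borel"
    and "\<And>x. x \<in> {vmin..vmax} \<Longrightarrow> \<bar>g x\<bar> \<le> C"
  shows "integrable M (\<lambda>\<omega>. g (V n \<omega>))"
proof (rule integrable_const_bound)
  show "AE \<omega> in M. norm (g (V n \<omega>)) \<le> C"
    by (rule eventually_mono[OF AE_mark_bounds]) (use assms(2) in simp)
qed measurable

text \<open>If no mark fell in the interval, positivity of \<open>f\<close> there would make the
  interval a Lebesgue null set, contradicting \<open>a < b\<close>.\<close>

lemma emeasure_mark_interval:
  assumes "vmin \<le> a" "a < b" "b \<le> vmax"
  shows "emeasure M (V n -` {a<..<b} \<inter> space M) \<noteq> 0"
proof
  assume "emeasure M (V n -` {a<..<b} \<inter> space M) = 0"
  then have "AE \<omega> in M. V n \<omega> \<notin> {a<..<b}"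
    by (subst AE_iff_measurable[OF _ refl]) (auto simp: vimage_def Int_def conj_commute)
  then have "AE x in lborel. 0 < ennreal (f x) \<longrightarrow> x \<notin> {a<..<b}"
    by (subst (asm) distributed_AE2[OF marks]) simp_all
  then have "AE x in lborel. x \<notin> {a<..<b}"
    by eventually_elim (use density_pos assms in force)
  then have "emeasure lborel {a<..<b} = 0"
    by (subst (asm) AE_iff_measurable[OF _ refl]) (auto simp: greaterThanLessThan_def greaterThan_def lessThan_def Int_def)
  with assms show False
    by simp
qed

text \<open>The gap between \<open>g\<close> and \<open>h\<close> on \<open>{a<..<b}\<close> is seen
  with positive probability. Every strict comparison of expectations below comes from here.\<close>

lemma expectation_mark_less:
  fixes g h :: "real \<Rightarrow> real"
  assumes "integrable M (\<lambda>\<omega>. g (V 0 \<omega>))" "integrable M (\<lambda>\<omega>. h (V 0 \<omega>))"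
    and "vmin \<le> a" "a < b" "b \<le> vmax"
    and "\<And>x. x \<in> {a<..<b} \<Longrightarrow> g x < h x"
    and "\<And>x. x \<in> {vmin..vmax} \<Longrightarrow> g x \<le> h x"
  shows "expectation (\<lambda>\<omega>. g (V 0 \<omega>)) < expectation (\<lambda>\<omega>. h (V 0 \<omega>))"
proof (rule integral_less_AE[OF assms(1,2) emeasure_mark_interval[OF assms(3-5)]])
  show "AE \<omega> in M. \<omega> \<in> V 0 -` {a<..<b} \<inter> space M \<longrightarrow> g (V 0 \<omega>) \<noteq> h (V 0 \<omega>)"
    using assms(6) by (intro AE_I2) force
  show "AE \<omega> in M. g (V 0 \<omega>) \<le> h (V 0 \<omega>)"
    by (rule eventually_mono[OF AE_mark_bounds]) (use assms(7) in simp)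
qed measurable

section \<open>Acceptance probability and runs of rejected marks\<close>

text \<open>Kept as the expectation of an indicator, so that linearity and the product rule for
  independent variables apply directly.\<close>

definition accept_prob :: "real \<Rightarrow> real" where
  "accept_prob r = expectation (\<lambda>\<omega>. indicator {r..} (V 0 \<omega>))"

lemma accept_prob_le_1: "accept_prob r \<le> 1"
proof -
  have "accept_prob r \<le> expectation (\<lambda>_. 1)"
    unfolding accept_prob_def
    by (intro integral_mono integrable_mark[where C = 1]) (auto simp: indicator_def)
  then show ?thesis
    by (simp add: prob_space)
qed

lemma accept_prob_pos:
  assumes "vmin \<le> r" "r < vmax"
  shows "0 < accept_prob r"
proof -
  have "expectation (\<lambda>\<omega>. 0) < accept_prob r"
    unfolding accept_prob_def
    using assms
    by (intro expectation_mark_less[where g = "\<lambda>_. 0" and a = r and b = vmax]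
          integrable_mark[where C = 1]) (auto simp: indicator_def)
  then show ?thesis
    by simp
qed

lemma reject_prob:
  "expectation (\<lambda>\<omega>. indicator {..<r} (V n \<omega>)) = 1 - accept_prob r"
proof -
  have "expectation (\<lambda>\<omega>. indicator {..<r} (V n \<omega>)) = expectation (\<lambda>\<omega>. indicator {..<r} (V 0 \<omega>) :: real)"
    by (rule expectation_mark) simp
  also have "\<dots> = expectation (\<lambda>\<omega>. 1 - indicator {r..} (V 0 \<omega>))"
    by (intro Bochner_Integration.integral_cong) (auto simp: indicator_def)
  also have "\<dots> = 1 - accept_prob r"
    unfolding accept_prob_def
    by (subst Bochner_Integration.integral_diff) (auto intro!: integrable_mark[where C = 1] simp: prob_space)
  finally show ?thesis .
qed

text \<open>The index \<open>j\<close> lives in the sum type so that one statement serves both the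
  next mark (\<open>Inr n\<close>) and the next gap (\<open>Inl n\<close>). The condition on
  \<open>j\<close> keeps its variable apart from the rejected marks, so the product of expectations
  applies.\<close>

lemma rejected_indep:
  fixes g :: "real \<Rightarrow> real"
  assumes [measurable]: "g \<in> borel_measurable borel"
    and int: "integrable M (\<lambda>\<omega>. g (case_sum A V j \<omega>))"
    and j: "\<And>i. i < n \<Longrightarrow> j \<noteq> Inr i"
  shows "integrable M (\<lambda>\<omega>. (\<Prod>i<n. indicator {..<r} (V i \<omega>)) * g (case_sum A V j \<omega>))"
    and "expectation (\<lambda>\<omega>. (\<Prod>i<n. indicator {..<r} (V i \<omega>)) * g (case_sum A V j \<omega>))
      = (1 - accept_prob r) ^ n * expectation (\<lambda>\<omega>. g (case_sum A V j \<omega>))"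
proof -
  \<comment> \<open>One family carrying \<open>g\<close> at \<open>j\<close> and the rejection
    indicator elsewhere; composing coordinatewise preserves independence.\<close>
  define Y where "Y = (\<lambda>k \<omega>. (if k = j then g else indicator {..<r}) (case_sum A V k \<omega>))"
  define I where "I = insert j (Inr ` {..<n})"
  have fin: "finite I" "j \<notin> Inr ` {..<n}"
    using j by (auto simp: I_def)
  have "indep_vars (\<lambda>_. borel) (case_sum A V) I"
    by (rule indep_vars_subset[OF indep]) simp
  then have ind: "indep_vars (\<lambda>_. borel) Y I"
    unfolding Y_def by (rule indep_vars_compose2) auto
  have Y_Inr: "Y (Inr i) = (\<lambda>\<omega>. indicator {..<r} (V i \<omega>))" if "i < n" for i
    using j[OF that] by (auto simp: Y_def)
  have Y_j: "Y j = (\<lambda>\<omega>. g (case_sum A V j \<omega>))"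
    by (simp add: Y_def)
  have intY: "integrable M (Y k)" if "k \<in> I" for k
    using that int by (auto simp: I_def Y_j Y_Inr intro!: integrable_mark[where C = 1])
  have prod: "(\<Prod>k\<in>I. Z k) = (\<Prod>i<n. Z (Inr i)) * Z j" for Z :: "_ \<Rightarrow> real"
    using fin by (simp add: I_def prod.reindex)
  have eq: "(\<lambda>\<omega>. \<Prod>k\<in>I. Y k \<omega>) = (\<lambda>\<omega>. (\<Prod>i<n. indicator {..<r} (V i \<omega>)) * g (case_sum A V j \<omega>))"
    by (simp add: prod Y_Inr Y_j)
  show "integrable M (\<lambda>\<omega>. (\<Prod>i<n. indicator {..<r} (V i \<omega>)) * g (case_sum A V j \<omega>))"
    using indep_vars_integrable[OF fin(1) ind intY] by (simp add: eq)
  show "expectation (\<lambda>\<omega>. (\<Prod>i<n. indicator {..<r} (V i \<omega>)) * g (case_sum A V j \<omega>))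
      = (1 - accept_prob r) ^ n * expectation (\<lambda>\<omega>. g (case_sum A V j \<omega>))"
    using indep_vars_lebesgue_integral[OF fin(1) ind intY]
    by (simp add: eq prod Y_Inr Y_j reject_prob)
qed

text \<open>Never meeting an acceptable mark implies \<open>n\<close> initial rejections for every
  \<open>n\<close>, an event of probability \<open>(1 - accept_prob r) ^ n\<close>, which tends to
  0.\<close>

lemma AE_acceptable_mark:
  assumes "vmin \<le> r" "r < vmax"
  shows "AE \<omega> in M. \<exists>n. r \<le> V n \<omega>"
proof -
  let ?N = "{\<omega> \<in> space M. \<forall>n. V n \<omega> < r}"
  have "prob ?N \<le> (1 - accept_prob r) ^ n" for n
  proof -
    have "prob ?N = expectation (indicator ?N)"
      by simp
    also have "\<dots> \<le> expectation (\<lambda>\<omega>. (\<Prod>i<n. indicator {..<r} (V i \<omega>)) * 1)"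
    proof (rule integral_mono)
      show "integrable M (indicator ?N :: 'a \<Rightarrow> real)"
        by (simp add: emeasure_eq_measure)
      show "integrable M (\<lambda>\<omega>. (\<Prod>i<n. indicator {..<r} (V i \<omega>)) * 1 :: real)"
        \<comment> \<open>With the constant function 1 any index outside the marks serves as the
          extra factor; the gap \<open>Inl 0\<close> is such an index.\<close>
        by (rule rejected_indep(1)[of "\<lambda>_. 1" "Inl 0"]) simp_all
      show "indicator ?N \<omega> \<le> ((\<Prod>i<n. indicator {..<r} (V i \<omega>)) * 1 :: real)" for \<omega>
        by (cases "\<forall>n. V n \<omega> < r") (simp_all add: prod_nonneg)
    qed
    also have "\<dots> = (1 - accept_prob r) ^ n * expectation (\<lambda>_. 1)"
      by (rule rejected_indep(2)[of "\<lambda>_. 1" "Inl 0"]) simp_all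
    also have "\<dots> = (1 - accept_prob r) ^ n"
      by (simp add: prob_space)
    finally show ?thesis .
  qed
  moreover have "(\<lambda>n. (1 - accept_prob r) ^ n) \<longlonglongrightarrow> 0"
    using accept_prob_le_1[of r] accept_prob_pos[OF assms] by (intro LIMSEQ_realpow_zero) auto
  ultimately have "prob ?N \<le> 0"
    by (meson LIMSEQ_le_const)
  then have "prob ?N = 0"
    by (simp add: measure_le_0_iff)
  then have "AE \<omega> in M. \<not> (\<forall>n. V n \<omega> < r)"
    by (subst AE_iff_measurable[OF _ refl]) (simp_all add: emeasure_eq_measure)
  then show ?thesis
    by (rule eventually_mono) (simp add: not_less)
qed

lemma integrable_gap: "integrable M (A n)"
  \<comment> \<open>The exponential law is the Erlang law of shape 0, and its first moment is
    finite.\<close>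
  using erlang_ith_moment_integrable[OF rate_pos gaps, of n 1] by simp

lemma expectation_gap: "expectation (A n) = 1 / lam"
  by (rule exponential_distributed_expectation[OF rate_pos gaps])


section \<open>From policy payoffs to waiting payoffs\<close>

lemma measurable_arrival_time [measurable]: "arrival_time A n \<in> borel_measurable M"
  unfolding arrival_time_def[abs_def] by measurable

lemma measurable_best_value [measurable]: "best_value V b n \<in> borel_measurable M"
proof (induction n)
  case 0
  then show ?case
    by (simp add: best_value_def[abs_def])
next
  case (Suc n)
  have "best_value V b (Suc n) = (\<lambda>\<omega>. max (V n \<omega>) (best_value V b n \<omega>))"
    by (simp add: fun_eq_iff best_value_def lessThan_Suc insert_commute[of b])
  with Suc show ?case
    by simp
qed

lemma measurable_first_mark_index [measurable]:
  "first_mark_index V r \<in> M \<rightarrow>\<^sub>M count_space UNIV"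
  unfolding first_mark_index_def[abs_def] by measurable

lemma measurable_exchange_index [measurable]:
  "exchange_index V r b \<in> M \<rightarrow>\<^sub>M count_space UNIV"
  unfolding exchange_index_def[abs_def] by measurable

text \<open>The random index takes countably many values, so fixed indices suffice. Measurability
  allows the integrand to be replaced by an almost surely equal one.\<close>

lemma measurable_waiting_integrand:
  "(\<lambda>\<omega>. V (first_mark_index V r \<omega>) \<omega>
      - cw * arrival_time A (Suc (first_mark_index V r \<omega>)) \<omega>) \<in> borel_measurable M"
  by (rule measurable_compose_countable[where g = "first_mark_index V r"
        and f = "\<lambda>n \<omega>. V n \<omega> - cw * arrival_time A (Suc n) \<omega>"]) measurable

lemma measurable_policy_integrand:
  "(\<lambda>\<omega>. best_value V b (exchange_index V r b \<omega>) \<omega>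
      - cw * arrival_time A (exchange_index V r b \<omega>) \<omega>) \<in> borel_measurable M"
  by (rule measurable_compose_countable[where g = "exchange_index V r b"
        and f = "\<lambda>n \<omega>. best_value V b n \<omega> - cw * arrival_time A n \<omega>"]) measurable

lemma policy_payoff_exchange:
  assumes "r \<le> b"
  shows "policy_payoff M A V cw r b = b"
proof -
  have "exchange_index V r b \<omega> = 0" for \<omega>
    using assms by (simp add: exchange_index_def best_value_def Least_eq_0)
  then show ?thesis
    by (simp add: policy_payoff_def best_value_def arrival_time_def prob_space)
qed

text \<open>As \<open>b < r\<close>, the recalled value never triggers the exchange. The first mark
  reaching \<open>r\<close> does, and it exceeds \<open>b\<close> and all earlier marks, so it is
  the best value at that moment.\<close>

lemma policy_payoff_wait:
  assumes "vmin \<le> r" "r < vmax" "b < r"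
  shows "policy_payoff M A V cw r b = waiting_payoff M A V cw r"
  unfolding policy_payoff_def waiting_payoff_def
proof (rule integral_cong_AE[OF measurable_policy_integrand measurable_waiting_integrand])
  show "AE \<omega> in M. best_value V b (exchange_index V r b \<omega>) \<omega>
          - cw * arrival_time A (exchange_index V r b \<omega>) \<omega>
        = V (first_mark_index V r \<omega>) \<omega>
          - cw * arrival_time A (Suc (first_mark_index V r \<omega>)) \<omega>"
    using AE_acceptable_mark[OF assms(1,2)]
  proof eventually_elim
    case (elim \<omega>)
    define N where "N = first_mark_index V r \<omega>"
    have N: "r \<le> V N \<omega>"
      unfolding N_def by (rule first_mark_index_ge[where V = V, OF elim])
    have before: "V i \<omega> < r" if "i < N" for i
      using that unfolding N_def by (rule less_first_mark_index)
    have reach: "r \<le> best_value V b n \<omega> \<longleftrightarrow> (\<exists>i<n. r \<le> V i \<omega>)" for n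
      unfolding best_value_def using assms(3) by (subst Max_ge_iff) auto
    \<comment> \<open>Marks are numbered from 0, while \<open>best_value V b n\<close> has seen the
      marks below \<open>n\<close>; mark \<open>N\<close> is therefore first available at
      \<open>Suc N\<close>.\<close>
    have index: "exchange_index V r b \<omega> = Suc N"
      unfolding exchange_index_def reach
    proof (rule Least_equality)
      show "\<exists>i<Suc N. r \<le> V i \<omega>"
        using N by blast
      show "Suc N \<le> n" if reached: "\<exists>i<n. r \<le> V i \<omega>" for n
      proof (rule ccontr)
        obtain i where i: "i < n" "r \<le> V i \<omega>"
          using reached by blast
        assume "\<not> Suc N \<le> n"
        with i before[of i] show False
          by simp
      qed
    qed
    have "best_value V b (Suc N) \<omega> = V N \<omega>"
      unfolding best_value_def
    proof (rule Max_eqI)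
      show "y \<le> V N \<omega>" if "y \<in> insert b ((\<lambda>i. V i \<omega>) ` {..<Suc N})" for y
        using that N less_imp_le[OF less_le_trans[OF before N]] assms(3)
        by (auto simp: lessThan_Suc)
    qed auto
    with index show ?case
      by (simp add: N_def)
  qed
qed

section \<open>Closed form of the waiting payoff\<close>

text \<open>Up to a null set the payoff is the series over \<open>n\<close> of \<open>V n * [r \<le> V n] - cw * A n\<close>, each
  term counted only if the first \<open>n\<close> marks were rejected; that event is independent of the term
  and has probability \<open>(1 - accept_prob r) ^ n\<close>, so the expectations form a geometric series.\<close>

lemma waiting_payoff_eq:
  assumes r: "vmin \<le> r" "r < vmax"
  shows "waiting_payoff M A V cw r
    = (expectation (\<lambda>\<omega>. V 0 \<omega> * indicator {r..} (V 0 \<omega>)) - cw / lam) / accept_prob r"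
proof -
  let ?p = "accept_prob r"
  let ?g = "\<lambda>x. x * indicator {r..} x :: real"
  define D :: "nat \<Rightarrow> 'a \<Rightarrow> real" where "D n \<omega> = (\<Prod>i<n. indicator {..<r} (V i \<omega>))" for n \<omega>
  define X where "X n \<omega> = D n \<omega> * ?g (V n \<omega>) - D n \<omega> * (cw * A n \<omega>)" for n \<omega>
  \<comment> \<open>\<open>CV\<close> and \<open>CA\<close> do not depend on \<open>n\<close>. They
    bound the mean of \<open>norm (X n \<omega>)\<close> by a geometric sequence, which justifies
    exchanging sum and integral.\<close>
  define CV where "CV = expectation (\<lambda>\<omega>. \<bar>?g (V 0 \<omega>)\<bar>)"
  define CA where "CA = (\<integral>x. exponential_density lam x * \<bar>cw * x\<bar> \<partial>lborel)"
  define K where "K = expectation (\<lambda>\<omega>. ?g (V 0 \<omega>)) - cw / lam"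
  have D_nonneg: "0 \<le> D n \<omega>" for n \<omega>
    by (auto simp: D_def intro!: prod_nonneg)
  have int_g: "integrable M (\<lambda>\<omega>. ?g (V n \<omega>))" for n
    by (rule integrable_mark[where C = "max \<bar>vmin\<bar> \<bar>vmax\<bar>"]) (auto simp: indicator_def)
  have int_cA: "integrable M (\<lambda>\<omega>. cw * A n \<omega>)" for n
    using integrable_gap by simp
  have p: "0 \<le> 1 - ?p" "1 - ?p < 1"
    using accept_prob_le_1[of r] accept_prob_pos[OF r] by auto
  have V_term: "integrable M (\<lambda>\<omega>. D n \<omega> * h (V n \<omega>))"
      "expectation (\<lambda>\<omega>. D n \<omega> * h (V n \<omega>)) = (1 - ?p) ^ n * expectation (\<lambda>\<omega>. h (V 0 \<omega>))"
    if "h \<in> borel_measurable borel" "integrable M (\<lambda>\<omega>. h (V n \<omega>))" for h n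
    using rejected_indep[of h "Inr n" n r] that expectation_mark[of h n]
    by (simp_all add: D_def)
  have A_term: "integrable M (\<lambda>\<omega>. D n \<omega> * h (A n \<omega>))"
      "expectation (\<lambda>\<omega>. D n \<omega> * h (A n \<omega>)) = (1 - ?p) ^ n * expectation (\<lambda>\<omega>. h (A n \<omega>))"
    if "h \<in> borel_measurable borel" "integrable M (\<lambda>\<omega>. h (A n \<omega>))" for h n
    using rejected_indep[of h "Inl n" n r] that by (simp_all add: D_def)
  have CA: "expectation (\<lambda>\<omega>. \<bar>cw * A n \<omega>\<bar>) = CA" for n
    unfolding CA_def
    by (rule distributed_integral[OF gaps, symmetric]) (use rate_pos in \<open>simp_all\<close>)
  have int_X: "integrable M (X n)" for n
    unfolding X_def[abs_def]
    using V_term(1)[of ?g n] A_term(1)[of "\<lambda>x. cw * x" n] int_g int_cA by simp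
  have exp_X: "expectation (X n) = (1 - ?p) ^ n * K" for n
    unfolding X_def[abs_def] K_def
    using V_term[of ?g n] A_term[of "\<lambda>x. cw * x" n] int_g int_cA
    by (simp add: expectation_gap right_diff_distrib)
  have norm_X: "expectation (\<lambda>\<omega>. norm (X n \<omega>)) \<le> (1 - ?p) ^ n * (CV + CA)" for n
  proof -
    have abs_terms: "integrable M (\<lambda>\<omega>. D n \<omega> * \<bar>?g (V n \<omega>)\<bar>)"
      "integrable M (\<lambda>\<omega>. D n \<omega> * \<bar>cw * A n \<omega>\<bar>)"
      using V_term(1)[of "\<lambda>x. \<bar>?g x\<bar>" n] A_term(1)[of "\<lambda>x. \<bar>cw * x\<bar>" n]
        integrable_abs[OF int_g] integrable_abs[OF int_cA] by simp_all
    have "expectation (\<lambda>\<omega>. norm (X n \<omega>))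
        \<le> expectation (\<lambda>\<omega>. D n \<omega> * \<bar>?g (V n \<omega>)\<bar> + D n \<omega> * \<bar>cw * A n \<omega>\<bar>)"
    proof (rule integral_mono)
      show "norm (X n \<omega>) \<le> D n \<omega> * \<bar>?g (V n \<omega>)\<bar> + D n \<omega> * \<bar>cw * A n \<omega>\<bar>" for \<omega>
        unfolding X_def real_norm_def
        by (rule order_trans[OF abs_triangle_ineq4]) (simp only: abs_mult[of "D n \<omega>"] abs_of_nonneg[OF D_nonneg])
    qed (use int_X abs_terms in auto)
    also have "\<dots> = (1 - ?p) ^ n * (CV + CA)"
      using abs_terms V_term(2)[of "\<lambda>x. \<bar>?g x\<bar>" n] A_term(2)[of "\<lambda>x. \<bar>cw * x\<bar>" n]
        integrable_abs[OF int_g] integrable_abs[OF int_cA]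
      by (simp add: CV_def CA distrib_left)
    finally show ?thesis .
  qed
  have finite_series: "AE \<omega> in M. summable (\<lambda>n. norm (X n \<omega>)) \<and>
      (\<Sum>n. X n \<omega>) = V (first_mark_index V r \<omega>) \<omega>
          - cw * arrival_time A (Suc (first_mark_index V r \<omega>)) \<omega>"
    using AE_acceptable_mark[OF r]
  proof eventually_elim
    case (elim \<omega>)
    define N where "N = first_mark_index V r \<omega>"
    have N: "r \<le> V N \<omega>"
      unfolding N_def by (rule first_mark_index_ge[where V = V, OF elim])
    have before: "V i \<omega> < r" if "i < N" for i
      using that unfolding N_def by (rule less_first_mark_index)
    \<comment> \<open>Past \<open>N\<close> the product \<open>D n \<omega>\<close> contains the
      factor of the accepted mark \<open>N\<close>, which is 0.\<close>
    have late: "X n \<omega> = 0" if "n \<notin> {..N}" for n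
    proof -
      have "D n \<omega> = 0"
        unfolding D_def using N that by (intro prod_zero) (auto intro!: bexI[of _ N])
      then show ?thesis
        by (simp add: X_def)
    qed
    \<comment> \<open>Up to \<open>N\<close> all factors of \<open>D n \<omega>\<close> are 1, and
      the marks before \<open>N\<close> lie below \<open>r\<close>, so only the gap cost remains
      until the mark \<open>V N \<omega>\<close> is collected.\<close>
    have early: "X n \<omega> = (if n = N then V N \<omega> else 0) - cw * A n \<omega>" if "n \<le> N" for n
    proof -
      have "D n \<omega> = 1"
        unfolding D_def using before that by (intro prod.neutral) auto
      then show ?thesis
        using that N before[of n] by (auto simp: X_def indicator_def)
    qed
    have "(\<Sum>n. X n \<omega>) = (\<Sum>n\<le>N. X n \<omega>)"
      by (rule suminf_finite) (use late in auto)
    also have "\<dots> = (\<Sum>n\<le>N. (if n = N then V N \<omega> else 0) - cw * A n \<omega>)"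
      by (rule sum.cong) (use early in auto)
    also have "\<dots> = V N \<omega> - cw * arrival_time A (Suc N) \<omega>"
      by (simp add: sum_subtractf sum_distrib_left arrival_time_def lessThan_Suc_atMost)
    moreover have "summable (\<lambda>n. norm (X n \<omega>))"
      by (rule summable_finite[of "{..N}"]) (use late in auto)
    ultimately show ?case
      by (simp add: N_def)
  qed
  have geometric: "(\<lambda>n. (1 - ?p) ^ n * c) sums (c / ?p)" for c
    using sums_mult2[OF geometric_sums[of "1 - ?p"], of c] p by simp
  have "waiting_payoff M A V cw r = (\<integral>\<omega>. (\<Sum>n. X n \<omega>) \<partial>M)"
    unfolding waiting_payoff_def
  proof (rule integral_cong_AE[OF measurable_waiting_integrand])
    show "(\<lambda>\<omega>. \<Sum>n. X n \<omega>) \<in> borel_measurable M"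
      by (rule borel_measurable_suminf) (use int_X in auto)
    show "AE \<omega> in M. V (first_mark_index V r \<omega>) \<omega>
        - cw * arrival_time A (Suc (first_mark_index V r \<omega>)) \<omega> = (\<Sum>n. X n \<omega>)"
      using finite_series by eventually_elim simp
  qed
  also have "\<dots> = (\<Sum>n. expectation (X n))"
  proof (rule integral_suminf[OF int_X])
    show "AE \<omega> in M. summable (\<lambda>n. norm (X n \<omega>))"
      using finite_series by eventually_elim simp
    show "summable (\<lambda>n. expectation (\<lambda>\<omega>. norm (X n \<omega>)))"
      by (rule summable_comparison_test'[OF sums_summable[OF geometric[of "CV + CA"]]])
        (use norm_X in simp)
  qed
  also have "\<dots> = K / ?p"
    using geometric[of K] by (simp add: exp_X sums_iff)
  finally show ?thesis
    by (simp add: K_def)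
qed


section \<open>The tail integral as an expected excess\<close>

lemma integrable_excess: "integrable M (\<lambda>\<omega>. max (V 0 \<omega> - \<rho>) 0)"
  by (rule integrable_mark[where C = "\<bar>vmin\<bar> + \<bar>vmax\<bar> + \<bar>\<rho>\<bar>"]) auto

lemma integrable_accepted_excess:
  "integrable M (\<lambda>\<omega>. (V 0 \<omega> - \<rho>) * indicator {r..} (V 0 \<omega>))"
  by (rule integrable_mark[where C = "\<bar>vmin\<bar> + \<bar>vmax\<bar> + \<bar>\<rho>\<bar>"]) (auto simp: indicator_def)

text \<open>The event that \<open>V 0\<close> exceeds \<open>x\<close> is written as an indicator
  evaluated at \<open>x\<close>, ready for exchanging the integrals over \<omega> and
  \<open>x\<close>.\<close>

lemma one_minus_mark_cdf:
  "1 - mark_cdf M V x = expectation (\<lambda>\<omega>. indicator {..<V 0 \<omega>} x)"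
proof -
  have eq: "(\<lambda>\<omega>. indicator {..<V 0 \<omega>} x :: real) = (\<lambda>\<omega>. 1 - indicator {..x} (V 0 \<omega>))"
    by (auto simp: indicator_def)
  have "mark_cdf M V x = expectation (\<lambda>\<omega>. indicator {..x} (V 0 \<omega>))"
    using integral_distr[of "V 0" M borel "indicator {..x} :: real \<Rightarrow> real"]
    by (simp add: mark_cdf_def cdf_def)
  moreover have "integrable M (\<lambda>\<omega>. indicator {..x} (V 0 \<omega>) :: real)"
    by (rule integrable_mark[where C = 1]) (auto simp: indicator_def)
  ultimately show ?thesis
    by (simp add: eq prob_space)
qed

text \<open>Layer-cake formula: by Fubini the integral over \<open>x\<close> is taken first, which
  measures the length of the interval from \<rho> to the mark.\<close>

lemma tail_integral_eq:
  "tail_integral M V vmax \<rho> = expectation (\<lambda>\<omega>. max (V 0 \<omega> - \<rho>) 0)"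
proof -
  interpret pair_sigma_finite M lborel ..
  let ?h = "\<lambda>\<omega> x. indicator {\<rho>..vmax} x * indicator {..<V 0 \<omega>} x :: real"
  have inner: "AE \<omega> in M. integrable lborel (?h \<omega>) \<and> (\<integral>x. ?h \<omega> x \<partial>lborel) = max (V 0 \<omega> - \<rho>) 0"
    using AE_mark_bounds[of 0]
  proof eventually_elim
    case (elim \<omega>)
    \<comment> \<open>The cutoff at \<open>vmax\<close> disappears because almost surely
      \<open>V 0 \<omega> \<le> vmax\<close>.\<close>
    then have "?h \<omega> = indicator {\<rho>..<V 0 \<omega>}"
      by (auto simp: indicator_def fun_eq_iff)
    then show ?case
      by (auto simp: max_def)
  qed
  have meas [measurable]: "case_prod ?h \<in> borel_measurable (M \<Otimes>\<^sub>M lborel)"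
    unfolding indicator_def lessThan_iff by measurable
  have "integrable (M \<Otimes>\<^sub>M lborel) (case_prod ?h)"
  proof (rule Fubini_integrable[OF meas])
    have "integrable M (\<lambda>\<omega>. \<integral>x. ?h \<omega> x \<partial>lborel)"
      by (subst integrable_cong_AE[OF _ _ eventually_mono[OF inner]])
        (auto intro!: integrable_excess borel_measurable_lebesgue_integral)
    then show "integrable M (\<lambda>\<omega>. \<integral>x. norm (case_prod ?h (\<omega>, x)) \<partial>lborel)"
      by simp
    show "AE \<omega> in M. integrable lborel (\<lambda>x. case_prod ?h (\<omega>, x))"
      using inner by eventually_elim simp
  qed
  from Fubini_integral[OF this]
  have "(\<integral>x. expectation (\<lambda>\<omega>. ?h \<omega> x) \<partial>lborel) = expectation (\<lambda>\<omega>. \<integral>x. ?h \<omega> x \<partial>lborel)" .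
  also have "\<dots> = expectation (\<lambda>\<omega>. max (V 0 \<omega> - \<rho>) 0)"
    by (rule integral_cong_AE[OF _ _ eventually_mono[OF inner]])
      (auto intro!: borel_measurable_lebesgue_integral)
  finally show ?thesis
    by (simp add: tail_integral_def set_lebesgue_integral_def one_minus_mark_cdf)
qed

lemma tail_integral_vmin: "tail_integral M V vmax vmin = expectation (\<lambda>\<omega>. V 0 \<omega> - vmin)"
  unfolding tail_integral_eq
  by (rule integral_cong_AE[OF _ _ eventually_mono[OF AE_mark_bounds[of 0]]]) auto

lemma tail_integral_vmax: "tail_integral M V vmax vmax = 0"
proof -
  have "expectation (\<lambda>\<omega>. max (V 0 \<omega> - vmax) 0) = expectation (\<lambda>\<omega>. 0)"
    by (rule integral_cong_AE[OF _ _ eventually_mono[OF AE_mark_bounds[of 0]]]) auto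
  then show ?thesis
    by (simp add: tail_integral_eq)
qed

lemma tail_integral_strict_antimono:
  assumes "vmin \<le> r" "r < s" "s \<le> vmax"
  shows "tail_integral M V vmax s < tail_integral M V vmax r"
  unfolding tail_integral_eq
  by (rule expectation_mark_less[OF integrable_excess integrable_excess assms])
    (use assms in auto)

text \<open>For each mark the excess is 1-Lipschitz in the threshold, and taking expectations keeps
  the constant 1.\<close>

lemma continuous_on_tail_integral: "continuous_on S (tail_integral M V vmax)"
proof (rule lipschitz_on_continuous_on, rule lipschitz_onI)
  fix r s
  have "\<bar>tail_integral M V vmax r - tail_integral M V vmax s\<bar>
      = \<bar>expectation (\<lambda>\<omega>. max (V 0 \<omega> - r) 0 - max (V 0 \<omega> - s) 0)\<bar>"
    unfolding tail_integral_eq by (simp add: integrable_excess)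
  also have "\<dots> \<le> expectation (\<lambda>\<omega>. \<bar>max (V 0 \<omega> - r) 0 - max (V 0 \<omega> - s) 0\<bar>)"
    by (rule integral_abs_bound)
  also have "\<dots> \<le> expectation (\<lambda>\<omega>. \<bar>r - s\<bar>)"
    by (rule integral_mono) (auto intro!: integrable_abs integrable_excess)
  finally show "dist (tail_integral M V vmax r) (tail_integral M V vmax s) \<le> 1 * dist r s"
    by (simp add: dist_real_def prob_space)
qed simp

section \<open>Comparison of thresholds and optimality\<close>

lemma waiting_payoff_minus:
  assumes "vmin \<le> r" "r < vmax"
  shows "accept_prob r * (waiting_payoff M A V cw r - \<rho>)
    = expectation (\<lambda>\<omega>. (V 0 \<omega> - \<rho>) * indicator {r..} (V 0 \<omega>)) - cw / lam"
proof -
  have "integrable M (\<lambda>\<omega>. V 0 \<omega> * indicator {r..} (V 0 \<omega>))"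
    using integrable_accepted_excess[of 0 r] by simp
  moreover have "integrable M (\<lambda>\<omega>. indicator {r..} (V 0 \<omega>) :: real)"
    by (rule integrable_mark[where C = 1]) (auto simp: indicator_def)
  ultimately have "expectation (\<lambda>\<omega>. (V 0 \<omega> - \<rho>) * indicator {r..} (V 0 \<omega>))
      = expectation (\<lambda>\<omega>. V 0 \<omega> * indicator {r..} (V 0 \<omega>)) - \<rho> * accept_prob r"
    by (simp add: accept_prob_def left_diff_distrib)
  then show ?thesis
    using accept_prob_pos[OF assms] by (simp add: waiting_payoff_eq[OF assms] right_diff_distrib[of _ _ \<rho>])
qed

lemma accepted_excess_eq:
  "expectation (\<lambda>\<omega>. (V 0 \<omega> - \<rho>) * indicator {\<rho>..} (V 0 \<omega>)) = tail_integral M V vmax \<rho>"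
  unfolding tail_integral_eq
  by (rule Bochner_Integration.integral_cong) (auto simp: indicator_def)

text \<open>A threshold below \<rho> admits marks with negative excess, one above \<rho> forgoes
  marks with positive excess. Both errors occur on the open interval between \<open>r\<close> and
  \<rho>, which marks hit with positive probability.\<close>

lemma accepted_excess_less:
  assumes "vmin \<le> r" "r \<le> vmax" "vmin \<le> \<rho>" "\<rho> \<le> vmax" "r \<noteq> \<rho>"
  shows "expectation (\<lambda>\<omega>. (V 0 \<omega> - \<rho>) * indicator {r..} (V 0 \<omega>)) < tail_integral M V vmax \<rho>"
  unfolding tail_integral_eq
  by (rule expectation_mark_less[OF integrable_accepted_excess integrable_excess,
        where a = "min r \<rho>" and b = "max r \<rho>"])
    (use assms in \<open>auto simp: indicator_def min_def max_def split: if_splits\<close>)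

lemma reservation_value:
  assumes "\<rho> \<in> {vmin..<vmax}" "lam * tail_integral M V vmax \<rho> = cw"
  shows "waiting_payoff M A V cw \<rho> = \<rho>"
    and "\<And>r. r \<in> {vmin..<vmax} \<Longrightarrow> r \<noteq> \<rho> \<Longrightarrow> waiting_payoff M A V cw r < \<rho>"
proof -
  have cost: "cw / lam = tail_integral M V vmax \<rho>"
    using assms(2) rate_pos by auto
  show "waiting_payoff M A V cw \<rho> = \<rho>"
    using waiting_payoff_minus[of \<rho> cw \<rho>] accept_prob_pos[of \<rho>] assms(1)
    by (simp add: cost accepted_excess_eq)
  fix r assume r: "r \<in> {vmin..<vmax}" "r \<noteq> \<rho>"
  then have "accept_prob r * (waiting_payoff M A V cw r - \<rho>) < 0"
    using waiting_payoff_minus[of r cw \<rho>] accepted_excess_less[of r \<rho>] assms(1) by (simp add: cost)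
  then show "waiting_payoff M A V cw r < \<rho>"
    using accept_prob_pos[of r] r by (simp add: mult_less_0_iff)
qed

lemma costly_waiting:
  assumes cost: "lam * tail_integral M V vmax vmin \<le> cw" and r: "r \<in> {vmin..<vmax}"
  shows "waiting_payoff M A V cw r \<le> vmin"
    and "r \<noteq> vmin \<Longrightarrow> waiting_payoff M A V cw r < waiting_payoff M A V cw vmin"
proof -
  have loss: "tail_integral M V vmax vmin - cw / lam \<le> 0"
    using cost rate_pos by (simp add: field_simps)
  have p: "0 < accept_prob r" "accept_prob r \<le> 1"
    using accept_prob_pos[of r] accept_prob_le_1[of r] r by auto
  \<comment> \<open>Almost every mark is at least \<open>vmin\<close>, so threshold
    \<open>vmin\<close> accepts the first arrival and no division by a probability remains.\<close>
  have "accept_prob vmin = expectation (\<lambda>\<omega>. 1)"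
    unfolding accept_prob_def
    by (rule integral_cong_AE[OF _ _ eventually_mono[OF AE_mark_bounds[of 0]]]) auto
  then have at_vmin: "waiting_payoff M A V cw vmin - vmin = tail_integral M V vmax vmin - cw / lam"
    using waiting_payoff_minus[of vmin cw vmin] vmin_less_vmax
    by (simp add: accepted_excess_eq prob_space)
  have less: "waiting_payoff M A V cw r < waiting_payoff M A V cw vmin" if "r \<noteq> vmin"
  proof -
    have "accept_prob r * (waiting_payoff M A V cw r - vmin) < tail_integral M V vmax vmin - cw / lam"
      using waiting_payoff_minus[of r cw vmin] accepted_excess_less[of r vmin] r that
      by simp
    \<comment> \<open>The bracket is nonpositive, so scaling it by a probability can only increase
      it.\<close>
    also have "\<dots> \<le> accept_prob r * (tail_integral M V vmax vmin - cw / lam)"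
      using mult_right_mono_neg[OF p(2) loss] by simp
    finally show ?thesis
      using p(1) at_vmin by simp
  qed
  then show "r \<noteq> vmin \<Longrightarrow> waiting_payoff M A V cw r < waiting_payoff M A V cw vmin" .
  show "waiting_payoff M A V cw r \<le> vmin"
    using less at_vmin loss by (cases "r = vmin") auto
qed

text \<open>The hypotheses cover both cost regimes: at an interior root the waiting payoff equals
  \<rho>, while at \<rho> = \<open>vmin\<close> it may fall short of \<rho>.\<close>

lemma optimal_threshold_iff:
  assumes \<rho>: "\<rho> \<in> {vmin..<vmax}"
    and le: "waiting_payoff M A V cw \<rho> \<le> \<rho>"
    and eq: "\<rho> = vmin \<or> waiting_payoff M A V cw \<rho> = \<rho>"
    and less: "\<And>r. r \<in> {vmin..<vmax} \<Longrightarrow> r \<noteq> \<rho> \<Longrightarrow>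
      waiting_payoff M A V cw r < waiting_payoff M A V cw \<rho>"
  shows "optimal_threshold M A V cw vmin vmax r \<longleftrightarrow> r = \<rho>"
proof
  have payoff: "policy_payoff M A V cw s b = (if s \<le> b then b else waiting_payoff M A V cw s)"
    if "s \<in> {vmin..<vmax}" for s b
    using that by (simp add: policy_payoff_exchange policy_payoff_wait)
  show "r = \<rho>" if "optimal_threshold M A V cw vmin vmax r"
  proof (rule ccontr)
    assume "r \<noteq> \<rho>"
    have r: "r \<in> {vmin..<vmax}"
      using that by (simp add: optimal_threshold_def)
    \<comment> \<open>The current value \<open>vmin - 1\<close> lies below both thresholds, so both
      policies wait and their waiting payoffs are compared directly.\<close>
    have "policy_payoff M A V cw \<rho> (vmin - 1) \<le> policy_payoff M A V cw r (vmin - 1)"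
      using that \<rho> by (simp add: optimal_threshold_def)
    with less[OF r \<open>r \<noteq> \<rho>\<close>] r \<rho> show False
      by (simp add: payoff)
  qed
  show "optimal_threshold M A V cw vmin vmax r" if "r = \<rho>"
    unfolding that optimal_threshold_def
  proof (intro conjI \<rho> ballI allI)
    fix s b assume s: "s \<in> {vmin..<vmax}"
    show "policy_payoff M A V cw s b \<le> policy_payoff M A V cw \<rho> b"
      \<comment> \<open>If \<open>s \<le> b < \<rho>\<close>, then \<rho> is not
        \<open>vmin\<close>, so waiting yields \<rho>, more than \<open>b\<close>. If
        \<open>\<rho> \<le> b < s\<close>, waiting yields less than the payoff of \<rho>, which is
        at most \<open>\<rho> \<le> b\<close>. Otherwise both policies exchange or both
        wait.\<close>
      using less[OF s] le eq s by (cases "s = \<rho>") (auto simp: payoff[OF s] payoff[OF \<rho>])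
  qed
qed

end

theorem theorem7:
  fixes M :: "'a measure"
    and lam cw vmin vmax :: real
    and A V :: "nat \<Rightarrow> 'a \<Rightarrow> real"
    and f :: "real \<Rightarrow> real"
  assumes "marked_poisson M lam A V f vmin vmax"
  shows "tail_integral M V vmax vmin = (\<integral>\<omega>. V 0 \<omega> - vmin \<partial>M)
    \<and> (0 < cw \<and> cw < lam * tail_integral M V vmax vmin \<longrightarrow>
        (\<exists>\<rho>\<in>{vmin<..<vmax}.
            lam * tail_integral M V vmax \<rho> = cw
          \<and> (\<forall>r\<in>{vmin<..<vmax}. lam * tail_integral M V vmax r = cw \<longrightarrow> r = \<rho>)
          \<and> (\<forall>r. optimal_threshold M A V cw vmin vmax r \<longleftrightarrow> r = \<rho>)
          \<and> \<rho> = waiting_payoff M A V cw \<rho>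
          \<and> (\<forall>r\<in>{vmin..<vmax}. waiting_payoff M A V cw r \<le> waiting_payoff M A V cw \<rho>)))
    \<and> (lam * tail_integral M V vmax vmin \<le> cw \<longrightarrow>
          (\<forall>b\<ge>vmin. \<forall>r\<in>{vmin..<vmax}. waiting_payoff M A V cw r \<le> b)
        \<and> (\<forall>r. optimal_threshold M A V cw vmin vmax r \<longleftrightarrow> r = vmin))"
proof -
  interpret marked_poisson M lam A V f vmin vmax
    by (rule assms)
  let ?T = "tail_integral M V vmax" and ?J = "waiting_payoff M A V cw"
  have "\<exists>\<rho>\<in>{vmin<..<vmax}. lam * ?T \<rho> = cw
          \<and> (\<forall>r\<in>{vmin<..<vmax}. lam * ?T r = cw \<longrightarrow> r = \<rho>)
          \<and> (\<forall>r. optimal_threshold M A V cw vmin vmax r \<longleftrightarrow> r = \<rho>)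
          \<and> \<rho> = ?J \<rho> \<and> (\<forall>r\<in>{vmin..<vmax}. ?J r \<le> ?J \<rho>)"
    if cost: "0 < cw" "cw < lam * ?T vmin"
  proof -
    \<comment> \<open>The level \<open>cw / lam\<close> lies strictly between
      \<open>?T vmax = 0\<close> and \<open>?T vmin\<close>; the same strictness then excludes both
      endpoints as roots.\<close>
    have "\<exists>\<rho>\<ge>vmin. \<rho> \<le> vmax \<and> ?T \<rho> = cw / lam"
      using cost rate_pos vmin_less_vmax
      by (intro IVT2' continuous_on_tail_integral) (auto simp: tail_integral_vmax field_simps)
    then obtain \<rho> where \<rho>: "vmin \<le> \<rho>" "\<rho> \<le> vmax" "lam * ?T \<rho> = cw"
      using rate_pos by (auto simp: field_simps)
    then have "\<rho> \<noteq> vmin" "\<rho> \<noteq> vmax"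
      using cost by (auto simp: tail_integral_vmax)
    with \<rho> have inside: "\<rho> \<in> {vmin<..<vmax}" "\<rho> \<in> {vmin..<vmax}"
      by auto
    note J = reservation_value[OF inside(2) \<rho>(3)]
    \<comment> \<open>Strict decrease of the tail integral on \<open>{vmin..vmax}\<close> rules out
      a second root.\<close>
    have unique: "r = \<rho>" if "r \<in> {vmin<..<vmax}" "lam * ?T r = cw" for r
      using tail_integral_strict_antimono[of r \<rho>] tail_integral_strict_antimono[of \<rho> r]
        that \<rho> rate_pos by (cases r \<rho> rule: linorder_cases) auto
    have "optimal_threshold M A V cw vmin vmax r \<longleftrightarrow> r = \<rho>" for r
      using inside J by (intro optimal_threshold_iff) simp_all
    moreover have "?J r \<le> ?J \<rho>" if "r \<in> {vmin..<vmax}" for r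
      using J that by (cases "r = \<rho>") (auto simp: less_imp_le)
    ultimately show ?thesis
      using inside(1) \<rho>(3) unique J(1)[symmetric] by blast
  qed
  moreover have "optimal_threshold M A V cw vmin vmax r \<longleftrightarrow> r = vmin"
    if "lam * ?T vmin \<le> cw" for r
    by (rule optimal_threshold_iff) (use costly_waiting[OF that] vmin_less_vmax in auto)
  moreover have "?J r \<le> b" if "lam * ?T vmin \<le> cw" "vmin \<le> b" "r \<in> {vmin..<vmax}" for r b
    using costly_waiting(1)[OF that(1,3)] that(2) by simp
  ultimately show ?thesis
    using tail_integral_vmin by blast
qed

end
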